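(* Let $\mathsf{k}$ be a field of characteristic $0$. Suppose that either (a) $I$ is a monomial ideal of $R=\mathsf{k}[x_1,x_2]$ with $\sqrt{I}=(x_1x_2)$, or (b) $I$ is a monomial ideal of $R=\mathsf{k}[x_1,x_2,x_3]$ with $\sqrt{I}=(x_1x_2x_3)$. Then there exists a positive integer $N$ such that the differential power $I^{\langle N\rangle}$ is a principal ideal.
   Context: For a commutative $\mathsf{k}$-algebra $R$ and $P,Q\in\operatorname{End}_{\mathsf{k}}(R)$, put $[P,Q]=P\cdot Q-Q\cdot P$. Identify $a\in R$ with the endomorphism "multiplication by $a$". Let $D^0_{\mathsf{k}}(R)\subseteq \operatorname{End}_{\mathsf{k}}(R)$ be the set of multiplications by elements of $R$, and for $i>0$ let $D^i_{\mathsf{k}}(R)=\{\partial\in\operatorname{End}_{\mathsf{k}}(R)\mid [\partial,a]\in D^{i-1}_{\mathsf{k}}(R)\text{ for all }a\in R\}$. For an ideal $I\subseteq R$ and a positive integer $n$, the $n$-th differential power of $I$ is the ideal $I^{\langle n\rangle}=\{r\in R\mid \partial(r)\in I\text{ for all }\partial\in D^{n-1}_{\mathsf{k}}(R)\}$. A monomial ideal is an ideal generated by monomials. *)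

theory Defs
  imports Complex_Main "HOL-Library.Poly_Mapping" "HOL-Library.Numeral_Type"
begin

section \<open>Ideals of a commutative ring\<close>

lemma module_times: "module ((*) :: 'r::comm_ring_1 \<Rightarrow> 'r \<Rightarrow> 'r)"
  by (rule module.intro) (simp_all add: algebra_simps)

text \<open>
  The ideal generated by \<open>S\<close> is the span of \<open>S\<close> in the ring as a module over itself. The module
  locale is deliberately not interpreted for \<open>(*)\<close>, because its rule \<open>scale_scale\<close> would then make
  the simplifier loop with \<open>mult.assoc\<close>.
\<close>

definition ideal_gen :: "'r::comm_ring_1 set \<Rightarrow> 'r set"
  where "ideal_gen S = module.span (*) S"

definition principal_ideal :: "'r::comm_ring_1 set \<Rightarrow> bool"
  where "principal_ideal I \<longleftrightarrow> (\<exists>r. I = ideal_gen {r})"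

definition radical :: "'r::comm_ring_1 set \<Rightarrow> 'r set"
  where "radical I = {r. \<exists>n>0. r ^ n \<in> I}"

section \<open>Differential operators and differential powers\<close>

locale comm_algebra = vector_space scale
  for scale :: "'k::field \<Rightarrow> 'r::comm_ring_1 \<Rightarrow> 'r" +
  assumes scale_mult_left: "scale c (a * b) = scale c a * b"
begin

definition End :: "('r \<Rightarrow> 'r) set"
  where "End = {P. Vector_Spaces.linear scale scale P}"

definition commutator :: "('r \<Rightarrow> 'r) \<Rightarrow> ('r \<Rightarrow> 'r) \<Rightarrow> 'r \<Rightarrow> 'r"
  where "commutator P Q = (\<lambda>r. P (Q r) - Q (P r))"

primrec diff_ops :: "nat \<Rightarrow> ('r \<Rightarrow> 'r) set"
  where
    "diff_ops 0 = {(*) a | a. True}"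
  | "diff_ops (Suc i) = {\<delta> \<in> End. \<forall>a. commutator \<delta> ((*) a) \<in> diff_ops i}"

text \<open>Only meaningful for \<open>n > 0\<close>, since the subtraction truncates at \<open>0\<close>.\<close>

definition diff_power :: "nat \<Rightarrow> 'r set \<Rightarrow> 'r set"
  where "diff_power n I = {r. \<forall>\<delta> \<in> diff_ops (n - 1). \<delta> r \<in> I}"

lemma scale_mult_right: "scale c (a * b) = a * scale c b"
  by (metis mult.commute scale_mult_left)

lemma mult_in_End: "(*) a \<in> End"
proof -
  have "Vector_Spaces.linear scale scale ((*) a)"
    by unfold_locales (simp_all add: distrib_left scale_mult_right)
  then show ?thesis
    by (simp add: End_def)
qed

lemma diff_ops_subset_End: "diff_ops i \<subseteq> End"
  by (cases i) (auto simp: mult_in_End)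

end

section \<open>Polynomial rings\<close>

text \<open>
  A polynomial over \<open>'k\<close> in variables indexed by \<open>'v\<close> is a finitely supported map from exponent
  vectors \<open>'v \<Rightarrow>\<^sub>0 nat\<close> to coefficients; multiplication on \<open>\<Rightarrow>\<^sub>0\<close> is convolution.
\<close>

type_synonym ('v, 'k) mpoly = "('v \<Rightarrow>\<^sub>0 nat) \<Rightarrow>\<^sub>0 'k"

definition monomial :: "('v \<Rightarrow>\<^sub>0 nat) \<Rightarrow> ('v, 'k::zero_neq_one) mpoly"
  where "monomial m = Poly_Mapping.single m 1"

definition Var :: "'v \<Rightarrow> ('v, 'k::zero_neq_one) mpoly"
  where "Var i = monomial (Poly_Mapping.single i 1)"

definition monomial_ideal :: "('v, 'k::field) mpoly set \<Rightarrow> bool"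
  where "monomial_ideal I \<longleftrightarrow> (\<exists>M. I = ideal_gen (monomial ` M))"

definition mpoly_scale :: "'k::field \<Rightarrow> ('v, 'k) mpoly \<Rightarrow> ('v, 'k) mpoly"
  where "mpoly_scale c p = Poly_Mapping.map ((*) c) p"

lemma mpoly_scale_conv_mult: "mpoly_scale c p = Poly_Mapping.single 0 c * p"
  by (simp add: mpoly_scale_def mult_map_scale_conv_mult)

global_interpretation mpoly: comm_algebra "mpoly_scale :: 'k::field \<Rightarrow> ('v, 'k) mpoly \<Rightarrow> _"
proof
  fix a b :: 'k and x y :: "('v, 'k) mpoly"
  show "mpoly_scale a (x + y) = mpoly_scale a x + mpoly_scale a y"
    by (simp add: mpoly_scale_conv_mult distrib_left)
  show "mpoly_scale (a + b) x = mpoly_scale a x + mpoly_scale b x"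
    by (simp add: mpoly_scale_conv_mult single_add distrib_right)
  show "mpoly_scale a (mpoly_scale b x) = mpoly_scale (a * b) x"
    by (simp add: mpoly_scale_conv_mult mult_single flip: mult.assoc)
  show "mpoly_scale 1 x = x"
    by (simp add: mpoly_scale_conv_mult)
  show "mpoly_scale a (x * y) = mpoly_scale a x * y"
    by (simp add: mpoly_scale_conv_mult mult.assoc)
qed

text \<open>
  For \<open>n\<close> variables the index type is the numeral type \<open>n\<close> with elements \<open>1, \<dots>, n\<close>, where \<open>n = 0\<close>
  in that type, so \<open>Var 1\<close> and \<open>Var 2\<close> are the two distinct variables of \<open>(2, 'k) mpoly\<close>, and
  similarly for \<open>3\<close>.
\<close>

lemma UNIV_numeral_2: "(UNIV :: 2 set) = {1, 2}" and one_neq_two_2: "(1 :: 2) \<noteq> 2"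
proof -
  show "(1 :: 2) \<noteq> 2" by simp
  have "card {1, 2 :: 2} = CARD(2)" by simp
  then show "(UNIV :: 2 set) = {1, 2}" by (metis card_subset_eq finite subset_UNIV)
qed

lemma UNIV_numeral_3: "(UNIV :: 3 set) = {1, 2, 3}" and distinct_numeral_3: "distinct [1, 2, 3 :: 3]"
proof -
  show "distinct [1, 2, 3 :: 3]" by simp
  have "card {1, 2, 3 :: 3} = CARD(3)" by simp
  then show "(UNIV :: 3 set) = {1, 2, 3}" by (metis card_subset_eq finite subset_UNIV)
qed

end

theory Submission
  imports Defs
begin

text \<open>
  In characteristic \<open>0\<close> the differential operators of order at most \<open>n\<close> on a polynomial ring see
  exactly the divisions of a monomial \<open>x\<^sup>u\<close> by monomials of degree at most \<open>n\<close>: an operator of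
  order at most \<open>n\<close> can only produce monomials that are multiples of such a quotient
  (\<open>diff_ops_deficit\<close>), and iterated partial derivatives produce all of them with nonzero
  coefficients (\<open>mem_if_deficit\<close>). Hence, if \<open>I\<close> is the monomial ideal with exponent set \<open>S\<close>, then
  \<open>I\<^sup>\<langle>\<^sup>N\<^sup>\<rangle>\<close> is the monomial ideal of the \<open>x\<^sup>u\<close> such that \<open>S\<close> contains every exponent vector reached
  from \<open>u\<close> by decreasing its coordinates by less than \<open>N\<close> in total (\<open>diff_power_supported\<close>).

  The remaining statement concerns upward closed \<open>S \<subseteq> \<nat>\<^sup>d\<close>, and it holds for every \<open>d\<close>. Let \<open>a\<^sub>i\<close> be
  the least \<open>i\<close>-th coordinate in \<open>S\<close>, attained at \<open>s\<^sub>i \<in> S\<close>, let \<open>M\<close> bound all coordinates of the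
  \<open>s\<^sub>i\<close>, and take \<open>N = 2M + 1\<close>. Spending all of the available decrease \<open>2M\<close> on the single
  coordinate \<open>i\<close> shows that \<open>u\<^sub>i \<ge> a\<^sub>i + 2M\<close> is necessary; this is where the condition on the
  radical enters, as it gives \<open>a\<^sub>i \<ge> 1\<close>, so that the decrease cannot be cut short at \<open>0\<close>.
  Conversely, if all these inequalities hold, then a total decrease of at most \<open>2M\<close> can bring at most
  one coordinate below \<open>M\<close>, say the \<open>i\<close>-th, which still is at least \<open>a\<^sub>i\<close>; so the result dominates
  \<open>s\<^sub>i\<close> and lies in \<open>S\<close>. The ideal \<open>I\<^sup>\<langle>\<^sup>N\<^sup>\<rangle>\<close> is therefore generated by the monomial with exponents
  \<open>a\<^sub>i + 2M\<close> (\<open>principal_differential_power\<close>).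
\<close>

section \<open>Operations on differential operators\<close>

context comm_algebra
begin

lemma EndI:
  assumes "\<And>x y. \<delta> (x + y) = \<delta> x + \<delta> y" and "\<And>c x. \<delta> (scale c x) = scale c (\<delta> x)"
  shows "\<delta> \<in> End"
proof -
  have "Vector_Spaces.linear scale scale \<delta>"
    by unfold_locales (simp_all add: assms)
  then show ?thesis
    by (simp add: End_def)
qed

lemma End_add: "\<delta> \<in> End \<Longrightarrow> \<delta> (x + y) = \<delta> x + \<delta> y"
  and End_scale: "\<delta> \<in> End \<Longrightarrow> \<delta> (scale c x) = scale c (\<delta> x)"
  by (auto simp: End_def Vector_Spaces.linear_iff)

lemma End_plus: "\<delta> \<in> End \<Longrightarrow> \<epsilon> \<in> End \<Longrightarrow> (\<lambda>r. \<delta> r + \<epsilon> r) \<in> End"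
  by (rule EndI) (simp_all add: End_add End_scale scale_right_distrib algebra_simps)

lemma End_comp: "\<delta> \<in> End \<Longrightarrow> \<epsilon> \<in> End \<Longrightarrow> (\<lambda>r. \<delta> (\<epsilon> r)) \<in> End"
  by (rule EndI) (simp_all add: End_add End_scale)

lemma diff_ops_End: "\<delta> \<in> diff_ops i \<Longrightarrow> \<delta> \<in> End"
  using diff_ops_subset_End by blast

lemma mult_in_diff_ops_0: "(\<lambda>r. a * r) \<in> diff_ops 0"
  by auto

lemma diff_ops_plus:
  "\<delta> \<in> diff_ops i \<Longrightarrow> \<epsilon> \<in> diff_ops i \<Longrightarrow> (\<lambda>r. \<delta> r + \<epsilon> r) \<in> diff_ops i"
proof (induction i arbitrary: \<delta> \<epsilon>)
  case 0
  then obtain a b where "\<delta> = (*) a" "\<epsilon> = (*) b"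
    by auto
  then have "(\<lambda>r. \<delta> r + \<epsilon> r) = (*) (a + b)"
    by (auto simp: algebra_simps)
  then show ?case
    by auto
next
  case (Suc i)
  have "commutator (\<lambda>r. \<delta> r + \<epsilon> r) ((*) a) =
      (\<lambda>r. commutator \<delta> ((*) a) r + commutator \<epsilon> ((*) a) r)" for a
    by (auto simp: commutator_def algebra_simps)
  moreover have "\<delta> \<in> End" "\<epsilon> \<in> End"
    using Suc.prems diff_ops_End by blast+
  ultimately show ?case
    using Suc by (simp add: End_plus)
qed

lemma diff_ops_comp_mult: "\<delta> \<in> diff_ops i \<Longrightarrow> (\<lambda>r. \<delta> (b * r)) \<in> diff_ops i"
proof (induction i arbitrary: \<delta>)
  case 0
  then obtain a where "\<delta> = (*) a"
    by auto
  then have "(\<lambda>r. \<delta> (b * r)) = (*) (a * b)"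
    by (auto simp: algebra_simps)
  then show ?case
    by auto
next
  case (Suc i)
  have "commutator (\<lambda>r. \<delta> (b * r)) ((*) a) = (\<lambda>r. commutator \<delta> ((*) a) (b * r))" for a
    by (auto simp: commutator_def mult.left_commute)
  moreover have "\<delta> \<in> End"
    using Suc.prems diff_ops_End by blast
  ultimately show ?case
    using Suc by (simp add: End_comp mult_in_End)
qed

lemma zero_in_diff_ops: "(\<lambda>r. 0) \<in> diff_ops i"
proof (induction i)
  case 0
  show ?case
    using mult_in_diff_ops_0[of 0] by simp
next
  case (Suc i)
  then show ?case
    by (simp add: commutator_def EndI)
qed

lemma diff_ops_le_Suc: "diff_ops i \<subseteq> diff_ops (Suc i)"
proof (induction i)
  case 0
  show ?case
  proof
    fix \<delta>
    assume "\<delta> \<in> diff_ops 0"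
    then obtain b where "\<delta> = (*) b"
      by auto
    then have "commutator \<delta> ((*) a) = (\<lambda>r. 0)" for a
      by (auto simp: commutator_def mult.left_commute)
    then show "\<delta> \<in> diff_ops (Suc 0)"
      using \<open>\<delta> = (*) b\<close> zero_in_diff_ops[of 0] by (simp add: mult_in_End)
  qed
next
  case (Suc i)
  then show ?case
    by auto
qed

lemma id_in_diff_ops: "(\<lambda>r. r) \<in> diff_ops i"
proof (induction i)
  case 0
  show ?case
    using mult_in_diff_ops_0[of 1] by simp
next
  case (Suc i)
  then show ?case
    using diff_ops_le_Suc by blast
qed

text \<open>
  Since \<open>[\<delta>\<partial>, a] = \<delta>[\<partial>, a] + [\<delta>, a]\<partial>\<close> and \<open>[\<partial>, a]\<close> is multiplication by \<open>\<partial>(a)\<close>, composing with a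
  derivation raises the order by at most one.
\<close>
lemma diff_ops_comp_derivation:
  assumes "D \<in> End" and leibniz: "\<And>a b. D (a * b) = a * D b + D a * b"
    and "\<delta> \<in> diff_ops i"
  shows "(\<lambda>r. \<delta> (D r)) \<in> diff_ops (Suc i)"
  using \<open>\<delta> \<in> diff_ops i\<close>
proof (induction i arbitrary: \<delta>)
  case 0
  then obtain b where b: "\<delta> = (*) b"
    by auto
  then have "commutator (\<lambda>r. \<delta> (D r)) ((*) a) = (*) (b * D a)" for a
    by (auto simp: commutator_def leibniz algebra_simps)
  then show ?case
    using b \<open>D \<in> End\<close> End_comp[OF mult_in_End, of D b] by auto
next
  case (Suc i)
  have \<delta>: "\<delta> \<in> End"
    using Suc.prems diff_ops_End by blast
  have "commutator (\<lambda>r. \<delta> (D r)) ((*) a) \<in> diff_ops (Suc i)" for a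
  proof -
    have "commutator (\<lambda>r. \<delta> (D r)) ((*) a) =
        (\<lambda>r. \<delta> (D a * r) + commutator \<delta> ((*) a) (D r))"
      by (auto simp: commutator_def leibniz End_add[OF \<delta>])
    moreover have "(\<lambda>r. \<delta> (D a * r)) \<in> diff_ops (Suc i)"
      by (rule diff_ops_comp_mult) (rule Suc.prems)
    moreover have "(\<lambda>r. commutator \<delta> ((*) a) (D r)) \<in> diff_ops (Suc i)"
      using Suc by simp
    ultimately show ?thesis
      using diff_ops_plus by presburger
  qed
  then show ?case
    using End_comp[OF \<delta> \<open>D \<in> End\<close>] diff_ops.simps(2)[of "Suc i"] by blast
qed

end

section \<open>Polynomials supported on a set of exponents\<close>

definition exp_le :: "('v \<Rightarrow>\<^sub>0 nat) \<Rightarrow> ('v \<Rightarrow>\<^sub>0 nat) \<Rightarrow> bool" (infix "\<preceq>" 50)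
  where "u \<preceq> w \<longleftrightarrow> (\<forall>i. Poly_Mapping.lookup u i \<le> Poly_Mapping.lookup w i)"

definition up_closed :: "('v \<Rightarrow>\<^sub>0 nat) set \<Rightarrow> bool"
  where "up_closed S \<longleftrightarrow> (\<forall>u\<in>S. \<forall>w. u \<preceq> w \<longrightarrow> w \<in> S)"

definition supported :: "('v \<Rightarrow>\<^sub>0 nat) set \<Rightarrow> ('v, 'k::zero) mpoly set"
  where "supported S = {p. Poly_Mapping.keys p \<subseteq> S}"

lemma exp_le_add: "u \<preceq> w + u"
  by (simp add: exp_le_def lookup_add)

lemma exp_le_minus_add: "u \<preceq> w \<Longrightarrow> w - u + u = w"
  by (rule poly_mapping_eqI) (simp add: exp_le_def lookup_add lookup_minus)

lemma mpoly_eq_sum_single: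
  "p = (\<Sum>u\<in>Poly_Mapping.keys p. Poly_Mapping.single u (Poly_Mapping.lookup p u))"
  by (rule poly_mapping_eqI)
    (auto simp: lookup_sum lookup_single when_def not_in_keys_iff_lookup_eq_zero)

lemma mpoly_single_add_induct [case_names single add]:
  fixes p :: "('v, 'k::comm_monoid_add) mpoly"
  assumes single: "\<And>u c. P (Poly_Mapping.single u c)"
    and add: "\<And>p q. P p \<Longrightarrow> P q \<Longrightarrow> P (p + q)"
  shows "P p"
proof -
  have "P (\<Sum>u\<in>A. Poly_Mapping.single u (Poly_Mapping.lookup p u))" if "finite A" for A
    using that
  proof (induction A)
    case empty
    show ?case
      using single[of 0 0] by simp
  qed (simp add: single add)
  then show ?thesis
    by (metis finite_keys mpoly_eq_sum_single)
qed

lemma monomial_add: "monomial (u + w) = (monomial u * monomial w :: ('v, 'k::comm_semiring_1) mpoly)"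
  by (simp add: monomial_def mult_single)

lemma keys_monomial: "Poly_Mapping.keys (monomial u) = {u}"
  by (simp add: monomial_def)

lemma single_eq_mpoly_scale_monomial:
  "Poly_Mapping.single u c = mpoly_scale (c::'k::field) (monomial u)"
  by (simp add: mpoly_scale_conv_mult monomial_def mult_single)

lemma keys_mpoly_scale: "Poly_Mapping.keys (mpoly_scale c p) \<subseteq> Poly_Mapping.keys p"
  unfolding mpoly_scale_conv_mult using keys_mult[of "Poly_Mapping.single 0 c" p]
  by (auto split: if_splits)

lemma module_subspace_supported:
  assumes "up_closed S"
  shows "module.subspace (*) (supported S :: ('v, 'k::comm_ring_1) mpoly set)"
proof -
  have "p * q \<in> supported S" if "q \<in> supported S" for p q :: "('v, 'k) mpoly"
  proof -
    have "a + b \<in> S" if "b \<in> S" for a b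
      using assms that exp_le_add unfolding up_closed_def by blast
    then show ?thesis
      using that keys_mult[of p q] by (fastforce simp: supported_def)
  qed
  moreover have "p + q \<in> supported S" if "p \<in> supported S" "q \<in> supported S" for p q :: "('v, 'k) mpoly"
    using that keys_add[of p q] by (auto simp: supported_def)
  ultimately show ?thesis
    by (simp add: module.subspace_def[OF module_times]) (simp add: supported_def)
qed

lemma up_closed_multiples: "up_closed {u. \<exists>m\<in>M. m \<preceq> u}"
  unfolding up_closed_def exp_le_def by (blast intro: order_trans)

lemma ideal_gen_monomials:
  "ideal_gen (monomial ` M) = (supported {u. \<exists>m\<in>M. m \<preceq> u} :: ('v, 'k::comm_ring_1) mpoly set)"
    (is "_ = supported ?S")
proof
  have "monomial ` M \<subseteq> (supported ?S :: ('v, 'k) mpoly set)"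
    by (auto simp: supported_def keys_monomial exp_le_def)
  then show "ideal_gen (monomial ` M) \<subseteq> (supported ?S :: ('v, 'k) mpoly set)"
    unfolding ideal_gen_def
    using module.span_minimal[OF module_times] module_subspace_supported[OF up_closed_multiples] by blast
next
  show "(supported ?S :: ('v, 'k) mpoly set) \<subseteq> ideal_gen (monomial ` M)"
  proof
    fix p :: "('v, 'k) mpoly"
    assume p: "p \<in> supported ?S"
    have "Poly_Mapping.single u (Poly_Mapping.lookup p u) \<in> ideal_gen (monomial ` M)"
      if u: "u \<in> Poly_Mapping.keys p" for u
    proof -
      obtain m where "m \<in> M" "m \<preceq> u"
        using p u by (auto simp: supported_def)
      then have "Poly_Mapping.single u (Poly_Mapping.lookup p u) =
          Poly_Mapping.single (u - m) (Poly_Mapping.lookup p u) * monomial m"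
        by (simp add: monomial_def mult_single exp_le_minus_add)
      then show ?thesis
        unfolding ideal_gen_def
        using \<open>m \<in> M\<close> module.span_scale[OF module_times] module.span_base[OF module_times]
        by (metis imageI)
    qed
    then show "p \<in> ideal_gen (monomial ` M)"
      using module.span_sum[OF module_times] mpoly_eq_sum_single[of p] unfolding ideal_gen_def
      by (metis (no_types, lifting))
  qed
qed

lemma ideal_gen_monomial: "ideal_gen {monomial v} = supported {u. v \<preceq> u}"
  using ideal_gen_monomials[of "{v}"] by simp

section \<open>Partial derivatives\<close>

definition partial :: "'v \<Rightarrow> ('v, 'k::semiring_1) mpoly \<Rightarrow> ('v, 'k) mpoly"
  where "partial i p = Abs_poly_mapping (\<lambda>u.
    of_nat (Suc (Poly_Mapping.lookup u i)) * Poly_Mapping.lookup p (u + Poly_Mapping.single i 1))"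

lemma lookup_partial:
  "Poly_Mapping.lookup (partial i p) u =
    of_nat (Suc (Poly_Mapping.lookup u i)) * Poly_Mapping.lookup p (u + Poly_Mapping.single i 1)"
proof -
  let ?shift = "\<lambda>u. u + Poly_Mapping.single i (1::nat)"
  have "finite (?shift -` Poly_Mapping.keys p)"
    by (rule finite_vimageI) (auto intro: injI)
  then have "finite {u. of_nat (Suc (Poly_Mapping.lookup u i)) * Poly_Mapping.lookup p (?shift u) \<noteq> 0}"
    by (rule rev_finite_subset) (auto simp: in_keys_iff)
  then show ?thesis
    by (simp add: partial_def)
qed

lemma partial_single:
  "partial i (Poly_Mapping.single u c) =
    Poly_Mapping.single (u - Poly_Mapping.single i 1) (of_nat (Poly_Mapping.lookup u i) * c)"
proof (rule poly_mapping_eqI)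
  fix w
  show "Poly_Mapping.lookup (partial i (Poly_Mapping.single u c)) w =
    Poly_Mapping.lookup (Poly_Mapping.single (u - Poly_Mapping.single i 1) (of_nat (Poly_Mapping.lookup u i) * c)) w"
  proof (cases "Poly_Mapping.lookup u i = 0")
    case True
    then have "u \<noteq> w + Poly_Mapping.single i 1"
      by (auto simp: lookup_add)
    then show ?thesis
      using True by (simp add: lookup_partial lookup_single)
  next
    case False
    then have "Poly_Mapping.single i 1 \<preceq> u"
      by (simp add: exp_le_def lookup_single when_def)
    then have shift: "u = w + Poly_Mapping.single i 1 \<longleftrightarrow> u - Poly_Mapping.single i 1 = w"
      by (metis exp_le_minus_add add_diff_cancel_right')
    show ?thesis
    proof (cases "u - Poly_Mapping.single i 1 = w")
      case True
      then have u: "u = w + Poly_Mapping.single i 1"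
        using shift by simp
      show ?thesis
        unfolding u by (simp add: lookup_partial lookup_add)
    next
      case False
      then show ?thesis
        using shift by (simp add: lookup_partial lookup_single)
    qed
  qed
qed

lemma partial_add: "partial i (p + q) = partial i p + partial i q"
  by (rule poly_mapping_eqI) (simp only: lookup_partial lookup_add distrib_left)

lemma leibniz_single:
  fixes c d :: "'k::comm_ring_1"
  shows "partial i (Poly_Mapping.single u c * Poly_Mapping.single w d) =
    Poly_Mapping.single u c * partial i (Poly_Mapping.single w d) +
    partial i (Poly_Mapping.single u c) * Poly_Mapping.single w d"
proof -
  have shift: "(a + b) - Poly_Mapping.single i 1 = a + (b - Poly_Mapping.single i 1)"
    if "Poly_Mapping.lookup b i \<noteq> 0" for a b :: "'a \<Rightarrow>\<^sub>0 nat"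
    using that by (intro poly_mapping_eqI) (auto simp: lookup_add lookup_minus lookup_single when_def)
  have "Poly_Mapping.single (u + w - Poly_Mapping.single i 1) (of_nat (Poly_Mapping.lookup w i) * (c * d)) =
      Poly_Mapping.single (u + (w - Poly_Mapping.single i 1)) (c * (of_nat (Poly_Mapping.lookup w i) * d))"
    using shift[of w u] by (cases "Poly_Mapping.lookup w i = 0") (simp_all add: algebra_simps)
  moreover have "Poly_Mapping.single (u + w - Poly_Mapping.single i 1) (of_nat (Poly_Mapping.lookup u i) * (c * d)) =
      Poly_Mapping.single (u - Poly_Mapping.single i 1 + w) (of_nat (Poly_Mapping.lookup u i) * c * d)"
    using shift[of u w] by (cases "Poly_Mapping.lookup u i = 0") (simp_all add: algebra_simps)
  ultimately show ?thesis
    by (simp add: mult_single partial_single lookup_add distrib_right single_add add.commute)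
qed

lemma leibniz:
  fixes p q :: "('v, 'k::comm_ring_1) mpoly"
  shows "partial i (p * q) = p * partial i q + partial i p * q"
proof (induction p rule: mpoly_single_add_induct)
  case (single u c)
  show ?case
    by (induction q rule: mpoly_single_add_induct)
      (simp_all only: leibniz_single partial_add algebra_simps)
qed (simp add: partial_add algebra_simps)

lemma partial_in_End: "partial i \<in> mpoly.End"
proof (rule mpoly.EndI)
  show "partial i (mpoly_scale c p) = mpoly_scale c (partial i p)" for c p
    by (simp add: mpoly_scale_conv_mult leibniz partial_single)
qed (rule partial_add)

section \<open>Differential powers of monomial ideals\<close>

text \<open>
  The deficit is the least degree of a monomial \<open>x\<^sup>\<alpha>\<close> dividing \<open>x\<^sup>u\<close> such that \<open>x\<^sup>w\<close> is a multiple
  of the quotient \<open>x\<^sup>u / x\<^sup>\<alpha>\<close>; the subtraction is the truncated one of \<open>\<nat>\<close>.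
\<close>
definition deficit :: "('v::finite \<Rightarrow>\<^sub>0 nat) \<Rightarrow> ('v \<Rightarrow>\<^sub>0 nat) \<Rightarrow> nat"
  where "deficit u w = (\<Sum>i\<in>UNIV. Poly_Mapping.lookup u i - Poly_Mapping.lookup w i)"

lemma deficit_eq_0_iff: "deficit u w = 0 \<longleftrightarrow> u \<preceq> w"
  by (simp add: deficit_def exp_le_def)

lemma deficit_add_right: "deficit (a + u) (a + w) = deficit u w"
  by (simp add: deficit_def lookup_add)

lemma deficit_add_single: "deficit (Poly_Mapping.single i 1 + u) w \<le> Suc (deficit u w)"
proof -
  have "deficit (Poly_Mapping.single i 1 + u) w \<le>
      (\<Sum>j\<in>UNIV. (if i = j then 1 else 0) + (Poly_Mapping.lookup u j - Poly_Mapping.lookup w j))"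
    unfolding deficit_def by (rule sum_mono) (auto simp: lookup_add lookup_single)
  then show ?thesis
    by (simp add: sum.distrib deficit_def)
qed

lemma deficit_minus_single:
  assumes "Poly_Mapping.lookup w i < Poly_Mapping.lookup u i"
  shows "deficit u w = Suc (deficit (u - Poly_Mapping.single i 1) w)"
proof -
  have "deficit u w =
      (\<Sum>j\<in>UNIV. (if i = j then 1 else 0) +
        (Poly_Mapping.lookup (u - Poly_Mapping.single i 1) j - Poly_Mapping.lookup w j))"
    unfolding deficit_def using assms
    by (intro sum.cong) (auto simp: lookup_minus lookup_single)
  then show ?thesis
    by (simp add: sum.distrib deficit_def)
qed

lemma exponent_induct [case_names zero add_single]:
  fixes u :: "'v::finite \<Rightarrow>\<^sub>0 nat"
  assumes "P 0" and "\<And>i u. P u \<Longrightarrow> P (Poly_Mapping.single i 1 + u)"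
  shows "P u"
proof (induction "deficit u 0" arbitrary: u)
  case 0
  then have "u = 0"
    by (intro poly_mapping_eqI) (auto simp: deficit_def)
  then show ?case
    using assms(1) by simp
next
  case (Suc n)
  then have "\<not> u \<preceq> 0"
    by (metis deficit_eq_0_iff nat.simps(3))
  then obtain i where i: "Poly_Mapping.lookup u i > 0"
    by (auto simp: exp_le_def not_le)
  then have "P (u - Poly_Mapping.single i 1)"
    using Suc deficit_minus_single[of 0 i u] by simp
  moreover have "Poly_Mapping.single i 1 \<preceq> u"
    using i by (simp add: exp_le_def lookup_single when_def)
  ultimately show ?case
    using assms(2) by (metis exp_le_minus_add add.commute)
qed

text \<open>
  Peeling one variable off the monomial, \<open>\<delta>(x\<^sub>i x\<^sup>u) = x\<^sub>i \<delta>(x\<^sup>u) + [\<delta>, x\<^sub>i](x\<^sup>u)\<close>: the first summand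
  keeps the deficit, and in the second one the order drops by one, which pays for the lost \<open>x\<^sub>i\<close>.
\<close>
lemma diff_ops_deficit_monomial:
  fixes \<delta> :: "('v::finite, 'k::field) mpoly \<Rightarrow> ('v, 'k) mpoly"
  assumes "\<delta> \<in> mpoly.diff_ops n" and "w \<in> Poly_Mapping.keys (\<delta> (monomial u))"
  shows "deficit u w \<le> n"
  using assms
proof (induction n arbitrary: \<delta> u w)
  case 0
  then obtain a where "\<delta> = (*) a"
    by auto
  then obtain b where "w = b + u"
    using 0 keys_mult[of a "monomial u"] by (auto simp: keys_monomial)
  then show ?case
    by (simp add: deficit_eq_0_iff exp_le_add)
next
  case (Suc n)
  show ?case
    using Suc.prems(2)
  proof (induction u arbitrary: w rule: exponent_induct)
    case zero
    show ?case
      by (simp add: deficit_def)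
  next
    case (add_single i u)
    let ?c = "mpoly.commutator \<delta> ((*) (Var i))"
    have "\<delta> (monomial (Poly_Mapping.single i 1 + u)) = Var i * \<delta> (monomial u) + ?c (monomial u)"
      by (simp add: mpoly.commutator_def Var_def monomial_add)
    then consider "w \<in> Poly_Mapping.keys (Var i * \<delta> (monomial u))"
      | "w \<in> Poly_Mapping.keys (?c (monomial u))"
      using add_single.prems keys_add by fastforce
    then show ?case
    proof cases
      case 1
      then obtain w' where "w = Poly_Mapping.single i 1 + w'" "w' \<in> Poly_Mapping.keys (\<delta> (monomial u))"
        using keys_mult[of "Var i" "\<delta> (monomial u)"] by (auto simp: Var_def keys_monomial)
      then show ?thesis
        using add_single.IH by (simp add: deficit_add_right)
    next
      case 2
      have "?c \<in> mpoly.diff_ops n"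
        using Suc.prems(1) by simp
      then have "deficit u w \<le> n"
        using Suc.IH 2 by blast
      then show ?thesis
        using deficit_add_single[of i u w] by linarith
    qed
  qed
qed

lemma diff_ops_deficit:
  fixes \<delta> :: "('v::finite, 'k::field) mpoly \<Rightarrow> ('v, 'k) mpoly"
  assumes \<delta>: "\<delta> \<in> mpoly.diff_ops n" and "w \<in> Poly_Mapping.keys (\<delta> p)"
  shows "\<exists>u\<in>Poly_Mapping.keys p. deficit u w \<le> n"
proof -
  have End: "\<delta> \<in> mpoly.End"
    using \<delta> by (rule mpoly.diff_ops_End)
  have "\<delta> (sum f A) = (\<Sum>u\<in>A. \<delta> (f u))" if "finite A" for f and A :: "('v \<Rightarrow>\<^sub>0 nat) set"
    using that
  proof (induction A)
    case empty
    show ?case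
      using mpoly.End_add[OF End, of 0 0] by simp
  qed (simp add: mpoly.End_add[OF End])
  then have "\<delta> p = (\<Sum>u\<in>Poly_Mapping.keys p. mpoly_scale (Poly_Mapping.lookup p u) (\<delta> (monomial u)))"
    by (subst mpoly_eq_sum_single[of p])
      (simp add: single_eq_mpoly_scale_monomial mpoly.End_scale[OF End])
  then obtain u where "u \<in> Poly_Mapping.keys p"
      and "w \<in> Poly_Mapping.keys (mpoly_scale (Poly_Mapping.lookup p u) (\<delta> (monomial u)))"
    using assms(2)
      keys_sum[of "\<lambda>u. mpoly_scale (Poly_Mapping.lookup p u) (\<delta> (monomial u))" "Poly_Mapping.keys p"]
    by auto
  then show ?thesis
    using diff_ops_deficit_monomial[OF \<delta>] keys_mpoly_scale by blast
qed

text \<open>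
  Each partial derivative in a direction where \<open>u\<close> exceeds \<open>w\<close> lowers the deficit by one; the
  coefficient of \<open>x\<^sup>u\<close> survives it because the derivative maps distinct monomials to multiples of
  distinct monomials and the exponent that comes down is invertible in characteristic \<open>0\<close>.
\<close>
lemma mem_if_deficit:
  fixes p :: "('v::finite, 'k::field_char_0) mpoly"
  assumes up: "up_closed S"
    and "\<forall>\<delta>\<in>mpoly.diff_ops n. \<delta> p \<in> supported S"
    and "u \<in> Poly_Mapping.keys p" and "deficit u w \<le> n"
  shows "w \<in> S"
  using assms(2-)
proof (induction n arbitrary: p u)
  case 0
  have "p \<in> supported S"
    using bspec[OF "0"(1) mpoly.id_in_diff_ops] by simp
  moreover have "u \<preceq> w"
    using 0 by (simp add: deficit_eq_0_iff)
  ultimately show ?case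
    using up 0 unfolding up_closed_def supported_def by blast
next
  case (Suc n)
  show ?case
  proof (cases "u \<preceq> w")
    case True
    have "p \<in> supported S"
      using bspec[OF Suc.prems(1) mpoly.id_in_diff_ops] by simp
    then show ?thesis
      using up Suc.prems True unfolding up_closed_def supported_def by blast
  next
    case False
    then obtain i where i: "Poly_Mapping.lookup w i < Poly_Mapping.lookup u i"
      by (auto simp: exp_le_def not_le)
    let ?u = "u - Poly_Mapping.single i 1"
    have "\<forall>\<delta>\<in>mpoly.diff_ops n. \<delta> (partial i p) \<in> supported S"
    proof
      fix \<delta> :: "('v, 'k) mpoly \<Rightarrow> ('v, 'k) mpoly"
      assume "\<delta> \<in> mpoly.diff_ops n"
      then show "\<delta> (partial i p) \<in> supported S"
        using bspec[OF Suc.prems(1) mpoly.diff_ops_comp_derivation[OF partial_in_End leibniz]]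
        by simp
    qed
    moreover have "?u + Poly_Mapping.single i 1 = u"
      using i by (intro exp_le_minus_add) (simp add: exp_le_def lookup_single when_def)
    then have "?u \<in> Poly_Mapping.keys (partial i p)"
      using Suc.prems(2) by (simp add: in_keys_iff lookup_partial del: of_nat_Suc)
    moreover have "deficit ?u w \<le> n"
      using deficit_minus_single[OF i] Suc.prems(3) by simp
    ultimately show ?thesis
      by (rule Suc.IH)
  qed
qed

lemma diff_power_supported:
  assumes "up_closed S" and "N > 0"
  shows "mpoly.diff_power N (supported S) =
    (supported {u. \<forall>w. deficit u w < N \<longrightarrow> w \<in> S} :: ('v::finite, 'k::field_char_0) mpoly set)"
    (is "?L = ?R")
proof
  show "?L \<subseteq> ?R"
    using mem_if_deficit[OF assms(1), of "N - 1"] assms(2)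
    by (fastforce simp: supported_def mpoly.diff_power_def)
next
  show "?R \<subseteq> ?L"
    using diff_ops_deficit[of _ "N - 1"] assms(2)
    by (fastforce simp: supported_def mpoly.diff_power_def)
qed

section \<open>Upward closed sets of exponents\<close>

lemma deficit_ge_pair:
  assumes "i \<noteq> j"
  shows "(Poly_Mapping.lookup u i - Poly_Mapping.lookup w i) +
    (Poly_Mapping.lookup u j - Poly_Mapping.lookup w j) \<le> deficit u w"
proof -
  have "(\<Sum>l\<in>{i, j}. Poly_Mapping.lookup u l - Poly_Mapping.lookup w l) \<le> deficit u w"
    unfolding deficit_def by (rule sum_mono2) auto
  then show ?thesis
    using assms by simp
qed

lemma deficit_ge_single: "Poly_Mapping.lookup u i - Poly_Mapping.lookup w i \<le> deficit u w"
  unfolding deficit_def by (rule member_le_sum) auto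

text \<open>
  Such a set looks like an orthant once only the points with enough room below them are kept: its
  minimal coordinates are all attained in the region where the other coordinates are at most \<open>M\<close>,
  and a decrease by at most \<open>2M\<close> cannot bring two coordinates from at least \<open>2M\<close> to below \<open>M\<close>.
\<close>
lemma up_closed_eventually_orthant:
  fixes S :: "('v::finite \<Rightarrow>\<^sub>0 nat) set"
  assumes up: "up_closed S" and "S \<noteq> {}"
    and pos: "\<And>u i. u \<in> S \<Longrightarrow> Poly_Mapping.lookup u i > 0"
  shows "\<exists>N>0. \<exists>v. {u. \<forall>w. deficit u w < N \<longrightarrow> w \<in> S} = {u. v \<preceq> u}"
proof -
  have "\<exists>s\<in>S. \<forall>u\<in>S. Poly_Mapping.lookup s i \<le> Poly_Mapping.lookup u i" for i
    using ex_has_least_nat[of "\<lambda>u. u \<in> S" _ "\<lambda>u. Poly_Mapping.lookup u i"] \<open>S \<noteq> {}\<close> by blast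
  then obtain s where s: "\<And>i. s i \<in> S"
      and least: "\<And>i u. u \<in> S \<Longrightarrow> Poly_Mapping.lookup (s i) i \<le> Poly_Mapping.lookup u i"
    by metis
  define M where "M = (\<Sum>i\<in>UNIV. \<Sum>j\<in>UNIV. Poly_Mapping.lookup (s i) j)"
  have M: "Poly_Mapping.lookup (s i) j \<le> M" for i j
  proof -
    have "Poly_Mapping.lookup (s i) j \<le> (\<Sum>j\<in>UNIV. Poly_Mapping.lookup (s i) j)"
      by (rule member_le_sum) auto
    also have "\<dots> \<le> M"
      unfolding M_def by (rule member_le_sum) auto
    finally show ?thesis .
  qed
  define v where "v = Abs_poly_mapping (\<lambda>i. Poly_Mapping.lookup (s i) i + 2 * M)"
  have v: "Poly_Mapping.lookup v i = Poly_Mapping.lookup (s i) i + 2 * M" for i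
    by (simp add: v_def)
  have "(\<forall>w. deficit u w < 2 * M + 1 \<longrightarrow> w \<in> S) \<longleftrightarrow> v \<preceq> u" for u
  proof
    assume u: "\<forall>w. deficit u w < 2 * M + 1 \<longrightarrow> w \<in> S"
    show "v \<preceq> u"
      unfolding exp_le_def
    proof
      fix i
      (* If the subtraction were cut short, w would have i-th coordinate 0, against positivity in S. *)
      define w where "w = u - Poly_Mapping.single i (2 * M)"
      have "deficit u w \<le> (\<Sum>j\<in>UNIV. if i = j then 2 * M else 0)"
        unfolding deficit_def w_def by (rule sum_mono) (auto simp: lookup_minus lookup_single)
      then have "w \<in> S"
        using u by simp
      then have "Poly_Mapping.lookup (s i) i \<le> Poly_Mapping.lookup u i - 2 * M"
        using least[of w i] by (simp add: w_def lookup_minus)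
      then show "Poly_Mapping.lookup v i \<le> Poly_Mapping.lookup u i"
        using pos[OF s, of i i] by (simp add: v)
    qed
  next
    assume "v \<preceq> u"
    then have u: "Poly_Mapping.lookup (s i) i + 2 * M \<le> Poly_Mapping.lookup u i" for i
      by (simp add: exp_le_def flip: v)
    show "\<forall>w. deficit u w < 2 * M + 1 \<longrightarrow> w \<in> S"
    proof (intro allI impI)
      fix w
      assume d: "deficit u w < 2 * M + 1"
      have "\<exists>i. s i \<preceq> w"
      proof (cases "\<exists>i. Poly_Mapping.lookup w i < M")
        case True
        then obtain i where i: "Poly_Mapping.lookup w i < M"
          by blast
        have "Poly_Mapping.lookup (s i) j \<le> Poly_Mapping.lookup w j" for j
        proof (cases "j = i")
          case True
          then show ?thesis
            using u[of i] d deficit_ge_single[of u i w] by simp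
        next
          case False
          (* The i-th coordinate has used up more than M of the decrease, so less than M is left. *)
          then have "M \<le> Poly_Mapping.lookup w j"
            using u[of i] u[of j] d i deficit_ge_pair[of j i u w] by linarith
          then show ?thesis
            using M[of i j] by linarith
        qed
        then show ?thesis
          unfolding exp_le_def by blast
      next
        case False
        then show ?thesis
          unfolding exp_le_def using M by (meson not_le order_trans)
      qed
      then show "w \<in> S"
        using up s unfolding up_closed_def by blast
    qed
  qed
  then show ?thesis
    by (intro exI[of _ "2 * M + 1"]) auto
qed

section \<open>Principal differential powers\<close>

lemma prod_Var:
  "(\<Prod>i\<in>A. Var i) = (monomial (\<Sum>i\<in>A. Poly_Mapping.single i 1) :: ('v, 'k::comm_ring_1) mpoly)"
  by (induction A rule: infinite_finite_induct) (simp_all add: Var_def monomial_add, simp_all add: monomial_def)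

lemma monomial_power_is_monomial: "\<exists>w. monomial u ^ n = (monomial w :: ('v, 'k::comm_ring_1) mpoly)"
proof (induction n)
  case 0
  show ?case
    by (intro exI[of _ 0]) (simp add: monomial_def)
next
  case (Suc n)
  then show ?case
    by (metis monomial_add power_Suc)
qed

theorem principal_differential_power:
  fixes I :: "('v::finite, 'k::field_char_0) mpoly set"
  assumes "monomial_ideal I" and rad: "radical I = ideal_gen {\<Prod>i\<in>UNIV. Var i}"
  shows "\<exists>N>0. principal_ideal (mpoly.diff_power N I)"
proof -
  obtain M where M: "I = ideal_gen (monomial ` M)"
    using assms(1) by (auto simp: monomial_ideal_def)
  define S where "S = {u. \<exists>m\<in>M. m \<preceq> u}"
  have I: "I = supported S" and up: "up_closed S"
    unfolding S_def M by (rule ideal_gen_monomials, rule up_closed_multiples)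
  define e :: "'v \<Rightarrow>\<^sub>0 nat" where "e = (\<Sum>i\<in>UNIV. Poly_Mapping.single i 1)"
  have e: "Poly_Mapping.lookup e i = 1" for i
    by (simp add: e_def lookup_sum lookup_single when_def)
  have rad_e: "radical I = supported {u. e \<preceq> u}"
    by (simp add: rad prod_Var ideal_gen_monomial e_def)
  have "monomial e \<in> radical I"
    unfolding rad_e by (simp add: supported_def keys_monomial exp_le_def)
  then obtain n where "monomial e ^ n \<in> I"
    by (auto simp: radical_def)
  then obtain w where "monomial w \<in> I"
    using monomial_power_is_monomial by metis
  then have "S \<noteq> {}"
    by (auto simp: I supported_def keys_monomial)
  have pos: "Poly_Mapping.lookup u i > 0" if "u \<in> S" for u i
  proof -
    have "monomial u ^ 1 \<in> I"
      using that by (simp add: I supported_def keys_monomial)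
    then have "monomial u \<in> radical I"
      unfolding radical_def using zero_less_one by fastforce
    then have "e \<preceq> u"
      by (simp add: rad_e supported_def keys_monomial)
    then show ?thesis
      using e unfolding exp_le_def by (metis less_le_trans zero_less_one)
  qed
  obtain N v where "N > 0" and "{u. \<forall>w. deficit u w < N \<longrightarrow> w \<in> S} = {u. v \<preceq> u}"
    using up_closed_eventually_orthant[OF up \<open>S \<noteq> {}\<close> pos] by blast
  then have "mpoly.diff_power N I = ideal_gen {monomial v}"
    by (simp add: I diff_power_supported[OF up] ideal_gen_monomial)
  then show ?thesis
    using \<open>N > 0\<close> unfolding principal_ideal_def by blast
qed

theorem theorem4p3:
  shows "(\<forall>I :: (2, 'k::field_char_0) mpoly set.
            monomial_ideal I \<and> radical I = ideal_gen {Var 1 * Var 2} \<longrightarrow>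
            (\<exists>N>0. principal_ideal (mpoly.diff_power N I)))
       \<and> (\<forall>I :: (3, 'k) mpoly set.
            monomial_ideal I \<and> radical I = ideal_gen {Var 1 * Var 2 * Var 3} \<longrightarrow>
            (\<exists>N>0. principal_ideal (mpoly.diff_power N I)))"
proof -
  have "(\<Prod>i\<in>UNIV. Var i) = (Var 1 * Var 2 :: (2, 'k) mpoly)"
    unfolding UNIV_numeral_2 using one_neq_two_2 by simp
  moreover have "(\<Prod>i\<in>UNIV. Var i) = (Var 1 * Var 2 * Var 3 :: (3, 'k) mpoly)"
    unfolding UNIV_numeral_3 using distinct_numeral_3 by (simp add: mult.assoc)
  ultimately show ?thesis
    using principal_differential_power[where ?'v = 2 and ?'k = 'k]
      principal_differential_power[where ?'v = 3 and ?'k = 'k] by simp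
qed

end
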